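(* Consider the $N$-stage decision problem $P_3$ with disturbances: minimize over the decisions the worst-case total cost $$\max_{\{w_1,\dots,w_N\}}\Big[\sum_{k=1}^{N}\tilde g_k(\boldsymbol s_k,\boldsymbol d_k,w_k)\Big],\qquad \boldsymbol s_{k+1}=\boldsymbol d_k+\boldsymbol\theta_k(w_k),$$ and suppose an optimal solution exists. Define functions $J^{[\mathrm{DP}]}_k:\mathscr S_k\to[-\infty,\infty]$ by $J^{[\mathrm{DP}]}_{N+1}(\boldsymbol s_{N+1})=0$ and, for $k=N,N-1,\dots,1$, $$J_k^{[\mathrm{DP}]}(\boldsymbol s_k)=\min_{\boldsymbol d_k\in\mathscr D_k(\boldsymbol s_k)}\ \max_{w_k\in\mathscr W_k(\boldsymbol s_k,\boldsymbol d_k)}\Big[\tilde g_k(\boldsymbol s_k,\boldsymbol d_k,w_k)+J_{k+1}^{[\mathrm{DP}]}\big(\boldsymbol d_k+\boldsymbol\theta_k(w_k)\big)\Big].$$ If every $J_k^{[\mathrm{DP}]}$ is bounded, then for every $\boldsymbol s_1\in\mathscr S_1$ the value produced by this recursion is the globally optimal value of $P_3$: $$J^*(\boldsymbol s_1):=\min_{\{\boldsymbol d_1,\dots,\boldsymbol d_N\}}\ \max_{\{w_1,\dots,w_N\}}\Big[\sum_{k=1}^{N}\tilde g_k(\boldsymbol s_k,\boldsymbol d_k,w_k)\Big]=J_1^{[\mathrm{DP}]}(\boldsymbol s_1).$$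
   Context: For $k=1,\dots,N+1$, $\mathscr S_k\subseteq\mathbb R^n$ is the state set at stage $k$. For $k=1,\dots,N$ and $\boldsymbol s_k\in\mathscr S_k$, $\mathscr D_k(\boldsymbol s_k)\subseteq\mathbb R^n$ is the nonempty set of admissible decisions. For $\boldsymbol d_k\in\mathscr D_k(\boldsymbol s_k)$, $\mathscr W_k(\boldsymbol s_k,\boldsymbol d_k)$ is the nonempty (otherwise arbitrary) set of possible disturbances $w_k$. The stage cost is $\tilde g_k(\boldsymbol s_k,\boldsymbol d_k,w_k)=g_k(\boldsymbol s_k,\boldsymbol d_k)+\varepsilon_k(w_k)$, where $g_k$ (exact cost) and $\varepsilon_k$ (estimation error) are real-valued. The state evolves by $\boldsymbol s_{k+1}=\boldsymbol d_k+\boldsymbol\theta_k(w_k)$, where $\boldsymbol\theta_k$ is an $\mathbb R^n$-valued state error; it is assumed that $\boldsymbol d_k+\boldsymbol\theta_k(w_k)\in\mathscr S_{k+1}$ for all admissible $\boldsymbol s_k,\boldsymbol d_k,w_k$. In the definition of $J^*(\boldsymbol s_1)$ the decisions are feedback policies: the outer minimum is over all tuples of functions $\boldsymbol d_k=\boldsymbol d_k(\cdot)$ on $\mathscr S_k$ with $\boldsymbol d_k(\boldsymbol s_k)\in\mathscr D_k(\boldsymbol s_k)$, and, for given policies, the inner maximum is over all sequences $(w_1,\dots,w_N)$ with $w_k\in\mathscr W_k(\boldsymbol s_k,\boldsymbol d_k(\boldsymbol s_k))$ along the resulting trajectory started at $\boldsymbol s_1$. Throughout, $\min$ and $\max$ are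 understood as infimum and supremum in $[-\infty,\infty]$ when not attained; "an optimal solution exists" means that in $P_3$ the minimum over policies and the maximum over disturbances are attained. *)

theory Defs
  imports "HOL-Analysis.Analysis"
begin

text \<open>
  Stages are numbered \<open>1, \<dots>, N\<close>, and \<open>S k\<close> is the state set for \<open>1 \<le> k \<le> N + 1\<close>; values of the
  problem data at other indices play no role. The disturbances of all stages live in one
  arbitrary type \<open>'w\<close>. Minima and maxima are infima and suprema in the type \<open>ereal\<close>.
\<close>

definition stage_cost ::
  "(nat \<Rightarrow> real ^ 'n \<Rightarrow> real ^ 'n \<Rightarrow> real) \<Rightarrow> (nat \<Rightarrow> 'w \<Rightarrow> real) \<Rightarrow>
   nat \<Rightarrow> real ^ 'n \<Rightarrow> real ^ 'n \<Rightarrow> 'w \<Rightarrow> real" where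
  "stage_cost g \<epsilon> k s d w = g k s d + \<epsilon> k w"

text \<open>A policy is a tuple of feedback functions; \<open>\<pi> k\<close> has domain \<open>S k\<close>.\<close>

definition policies ::
  "nat \<Rightarrow> (nat \<Rightarrow> (real ^ 'n) set) \<Rightarrow> (nat \<Rightarrow> real ^ 'n \<Rightarrow> (real ^ 'n) set) \<Rightarrow>
   (nat \<Rightarrow> real ^ 'n \<Rightarrow> real ^ 'n) set" where
  "policies N S D = (\<Pi>\<^sub>E k\<in>{1..N}. \<Pi>\<^sub>E s\<in>S k. D k s)"

text \<open>The state at stage \<open>k \<ge> 1\<close>, so that \<open>trajectory \<theta> \<pi> w s1 1 = s1\<close>; index 0 is a dummy.\<close>

primrec trajectory ::
  "(nat \<Rightarrow> 'w \<Rightarrow> real ^ 'n) \<Rightarrow> (nat \<Rightarrow> real ^ 'n \<Rightarrow> real ^ 'n) \<Rightarrow> (nat \<Rightarrow> 'w) \<Rightarrow> real ^ 'n \<Rightarrow>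
   nat \<Rightarrow> real ^ 'n" where
  "trajectory \<theta> \<pi> w s1 0 = s1"
| "trajectory \<theta> \<pi> w s1 (Suc k) =
     (if k = 0 then s1 else \<pi> k (trajectory \<theta> \<pi> w s1 k) + \<theta> k (w k))"

definition disturbances ::
  "nat \<Rightarrow> (nat \<Rightarrow> real ^ 'n \<Rightarrow> real ^ 'n \<Rightarrow> 'w set) \<Rightarrow> (nat \<Rightarrow> 'w \<Rightarrow> real ^ 'n) \<Rightarrow>
   (nat \<Rightarrow> real ^ 'n \<Rightarrow> real ^ 'n) \<Rightarrow> real ^ 'n \<Rightarrow> (nat \<Rightarrow> 'w) set" where
  "disturbances N W \<theta> \<pi> s1 =
     {w \<in> extensional {1..N}. \<forall>k\<in>{1..N}.
        w k \<in> W k (trajectory \<theta> \<pi> w s1 k) (\<pi> k (trajectory \<theta> \<pi> w s1 k))}"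

definition total_cost ::
  "nat \<Rightarrow> (nat \<Rightarrow> real ^ 'n \<Rightarrow> real ^ 'n \<Rightarrow> real) \<Rightarrow> (nat \<Rightarrow> 'w \<Rightarrow> real) \<Rightarrow>
   (nat \<Rightarrow> 'w \<Rightarrow> real ^ 'n) \<Rightarrow> (nat \<Rightarrow> real ^ 'n \<Rightarrow> real ^ 'n) \<Rightarrow> (nat \<Rightarrow> 'w) \<Rightarrow> real ^ 'n \<Rightarrow> real" where
  "total_cost N g \<epsilon> \<theta> \<pi> w s1 =
     (\<Sum>k=1..N. stage_cost g \<epsilon> k (trajectory \<theta> \<pi> w s1 k) (\<pi> k (trajectory \<theta> \<pi> w s1 k)) (w k))"

definition worst_case_cost ::
  "nat \<Rightarrow> (nat \<Rightarrow> real ^ 'n \<Rightarrow> real ^ 'n \<Rightarrow> 'w set) \<Rightarrow>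
   (nat \<Rightarrow> real ^ 'n \<Rightarrow> real ^ 'n \<Rightarrow> real) \<Rightarrow> (nat \<Rightarrow> 'w \<Rightarrow> real) \<Rightarrow> (nat \<Rightarrow> 'w \<Rightarrow> real ^ 'n) \<Rightarrow>
   (nat \<Rightarrow> real ^ 'n \<Rightarrow> real ^ 'n) \<Rightarrow> real ^ 'n \<Rightarrow> ereal" where
  "worst_case_cost N W g \<epsilon> \<theta> \<pi> s1 =
     (SUP w\<in>disturbances N W \<theta> \<pi> s1. ereal (total_cost N g \<epsilon> \<theta> \<pi> w s1))"

definition J_opt ::
  "nat \<Rightarrow> (nat \<Rightarrow> (real ^ 'n) set) \<Rightarrow> (nat \<Rightarrow> real ^ 'n \<Rightarrow> (real ^ 'n) set) \<Rightarrow>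
   (nat \<Rightarrow> real ^ 'n \<Rightarrow> real ^ 'n \<Rightarrow> 'w set) \<Rightarrow>
   (nat \<Rightarrow> real ^ 'n \<Rightarrow> real ^ 'n \<Rightarrow> real) \<Rightarrow> (nat \<Rightarrow> 'w \<Rightarrow> real) \<Rightarrow> (nat \<Rightarrow> 'w \<Rightarrow> real ^ 'n) \<Rightarrow>
   real ^ 'n \<Rightarrow> ereal" where
  "J_opt N S D W g \<epsilon> \<theta> s1 = (INF \<pi>\<in>policies N S D. worst_case_cost N W g \<epsilon> \<theta> \<pi> s1)"

text \<open>
  For the initial state \<open>s1\<close>, some policy attains the outer minimum, and for that policy some
  disturbance sequence attains the inner maximum.
\<close>

definition optimal_solution_exists ::
  "nat \<Rightarrow> (nat \<Rightarrow> (real ^ 'n) set) \<Rightarrow> (nat \<Rightarrow> real ^ 'n \<Rightarrow> (real ^ 'n) set) \<Rightarrow>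
   (nat \<Rightarrow> real ^ 'n \<Rightarrow> real ^ 'n \<Rightarrow> 'w set) \<Rightarrow>
   (nat \<Rightarrow> real ^ 'n \<Rightarrow> real ^ 'n \<Rightarrow> real) \<Rightarrow> (nat \<Rightarrow> 'w \<Rightarrow> real) \<Rightarrow> (nat \<Rightarrow> 'w \<Rightarrow> real ^ 'n) \<Rightarrow>
   real ^ 'n \<Rightarrow> bool" where
  "optimal_solution_exists N S D W g \<epsilon> \<theta> s1 \<longleftrightarrow>
     (\<exists>\<pi>\<in>policies N S D. \<exists>w\<in>disturbances N W \<theta> \<pi> s1.
        worst_case_cost N W g \<epsilon> \<theta> \<pi> s1 = J_opt N S D W g \<epsilon> \<theta> s1 \<and>
        ereal (total_cost N g \<epsilon> \<theta> \<pi> w s1) = worst_case_cost N W g \<epsilon> \<theta> \<pi> s1)"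

text \<open>
  Backward recursion from stage \<open>N + 1\<close>. The stage cost is finite, so the sum below is never of
  the form \<open>\<infinity> - \<infinity>\<close>.
\<close>

function J_DP ::
  "nat \<Rightarrow> (nat \<Rightarrow> real ^ 'n \<Rightarrow> (real ^ 'n) set) \<Rightarrow>
   (nat \<Rightarrow> real ^ 'n \<Rightarrow> real ^ 'n \<Rightarrow> 'w set) \<Rightarrow>
   (nat \<Rightarrow> real ^ 'n \<Rightarrow> real ^ 'n \<Rightarrow> real) \<Rightarrow> (nat \<Rightarrow> 'w \<Rightarrow> real) \<Rightarrow> (nat \<Rightarrow> 'w \<Rightarrow> real ^ 'n) \<Rightarrow>
   nat \<Rightarrow> real ^ 'n \<Rightarrow> ereal" where
  "J_DP N D W g \<epsilon> \<theta> k s =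
     (if k \<ge> N + 1 then 0
      else (INF d\<in>D k s. SUP w\<in>W k s d.
              ereal (stage_cost g \<epsilon> k s d w) + J_DP N D W g \<epsilon> \<theta> (k + 1) (d + \<theta> k w)))"
  by pat_completeness auto
termination
  by (relation "Wellfounded.measure (\<lambda>(N, _, _, _, _, _, k, _). N + 1 - k)") auto

declare J_DP.simps [simp del]

end

theory Submission
  imports Defs
begin

text \<open>
  By boundedness the recursion is real-valued, so for every \<open>\<eta> > 0\<close> there is a policy that is
  \<open>\<eta>\<close>-optimal in the Bellman equation at every state, and against any policy there is a feedback
  choice of disturbances that is \<open>\<eta>\<close>-worst at every state. Along a trajectory the Bellman
  inequalities telescope, so the total cost differs from the DP value by at most \<open>N * \<eta>\<close>.
\<close>

text \<open>Meant for \<open>c\<close> the stage costs and \<open>x\<close> the DP values along one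
  trajectory: each stage loses at most \<eta> in the Bellman inequality, and the intermediate values
  cancel.\<close>

lemma telescoping_upper:
  fixes c x :: "nat \<Rightarrow> real"
  assumes "\<And>k. k \<in> {1..N} \<Longrightarrow> c k + x (Suc k) \<le> x k + \<eta>"
  shows "(\<Sum>k=1..N. c k) + x (Suc N) \<le> x 1 + real N * \<eta>"
  using assms
proof (induction N)
  case (Suc N)
  have "(\<Sum>k=1..N. c k) + x (Suc N) \<le> x 1 + real N * \<eta>"
    using Suc by simp
  moreover have "c (Suc N) + x (Suc (Suc N)) \<le> x (Suc N) + \<eta>"
    using Suc.prems by simp
  ultimately show ?case
    by (simp add: algebra_simps)
qed simp

lemma telescoping_lower:
  fixes c x :: "nat \<Rightarrow> real"
  assumes "\<And>k. k \<in> {1..N} \<Longrightarrow> x k - \<eta> \<le> c k + x (Suc k)"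
  shows "x 1 - real N * \<eta> \<le> (\<Sum>k=1..N. c k) + x (Suc N)"
  using telescoping_upper[of N "\<lambda>k. - c k" "\<lambda>k. - x k" \<eta>] assms
  by (force simp: sum_negf algebra_simps)

lemma policies_apply_mem:
  assumes "\<pi> \<in> policies N S D" "k \<in> {1..N}" "s \<in> S k"
  shows "\<pi> k s \<in> D k s"
  using assms unfolding policies_def by (meson PiE_mem)

lemma disturbances_apply_mem:
  assumes "w \<in> disturbances N W \<theta> \<pi> s1" "k \<in> {1..N}"
  shows "w k \<in> W k (trajectory \<theta> \<pi> w s1 k) (\<pi> k (trajectory \<theta> \<pi> w s1 k))"
  using assms unfolding disturbances_def by blast

lemma trajectory_mem:
  assumes next_state: "\<And>k s d w. k \<in> {1..N} \<Longrightarrow> s \<in> S k \<Longrightarrow> d \<in> D k s \<Longrightarrow> w \<in> W k s d \<Longrightarrow>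
      d + \<theta> k w \<in> S (k + 1)"
    and "s1 \<in> S 1" "\<pi> \<in> policies N S D" "w \<in> disturbances N W \<theta> \<pi> s1"
    and "k \<in> {1..N + 1}"
  shows "trajectory \<theta> \<pi> w s1 k \<in> S k"
  using \<open>k \<in> {1..N + 1}\<close>
proof (induction k)
  case (Suc k)
  show ?case
  \<comment> \<open>Stages start at 1 and index 0 is a dummy, so the true base case of the induction
    is \<open>Suc 0\<close>.\<close>
  proof (cases "k = 0")
    case False
    with Suc.prems have k: "k \<in> {1..N}"
      by simp
    with Suc have "trajectory \<theta> \<pi> w s1 k \<in> S k"
      by simp
    with k assms(3,4) False show ?thesis
      using next_state[of k] policies_apply_mem[of \<pi> N S D k] disturbances_apply_mem[of w N W \<theta> \<pi> s1 k]
      by simp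
  qed (use \<open>s1 \<in> S 1\<close> in simp)
qed simp

text \<open>Admissibility of a sequence \<open>w\<close> refers to the trajectory that
  \<open>w\<close> itself generates. The circle is broken by running the closed-loop system first,
  with both \<pi> and \<omega> as feedback, and then reading the disturbances off its
  states.\<close>

lemma feedback_disturbance_exists:
  assumes next_state: "\<And>k s d w. k \<in> {1..N} \<Longrightarrow> s \<in> S k \<Longrightarrow> d \<in> D k s \<Longrightarrow> w \<in> W k s d \<Longrightarrow>
      d + \<theta> k w \<in> S (k + 1)"
    and "s1 \<in> S 1" "\<pi> \<in> policies N S D"
    and \<omega>: "\<And>k s. k \<in> {1..N} \<Longrightarrow> s \<in> S k \<Longrightarrow> \<omega> k s \<in> W k s (\<pi> k s)"
  obtains w where "w \<in> disturbances N W \<theta> \<pi> s1"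
    "\<And>k. k \<in> {1..N} \<Longrightarrow> w k = \<omega> k (trajectory \<theta> \<pi> w s1 k)"
proof -
  \<comment> \<open>The closed-loop states, with the same dummy index 0 as
    \<open>trajectory\<close>.\<close>
  define z where "z = rec_nat s1 (\<lambda>k s. if k = 0 then s1 else \<pi> k s + \<theta> k (\<omega> k s))"
  have z_Suc: "z (Suc k) = (if k = 0 then s1 else \<pi> k (z k) + \<theta> k (\<omega> k (z k)))" for k
    by (simp add: z_def)
  define w where "w = restrict (\<lambda>k. \<omega> k (z k)) {1..N}"
  \<comment> \<open>The state at stage \<open>k\<close> depends only on disturbances at earlier
    stages, so the restriction of \<open>w\<close> to \<open>{1..N}\<close> does no harm up to stage
    \<open>N + 1\<close>.\<close>
  have traj: "trajectory \<theta> \<pi> w s1 k = z k" if "k \<le> N + 1" for k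
    using that by (induction k) (auto simp: z_Suc w_def, simp add: z_def)
  have z_mem: "z k \<in> S k" if "k \<in> {1..N + 1}" for k
    using that
  proof (induction k)
    case (Suc k)
    then show ?case
      using next_state[of k "z k" "\<pi> k (z k)" "\<omega> k (z k)"] \<omega>[of k "z k"]
        policies_apply_mem[of \<pi> N S D k "z k"] \<open>s1 \<in> S 1\<close> \<open>\<pi> \<in> policies N S D\<close>
      by (auto simp: z_Suc)
  qed simp
  show thesis
  proof (rule that)
    show "w \<in> disturbances N W \<theta> \<pi> s1"
      using \<omega> z_mem by (auto simp: disturbances_def traj) (auto simp: w_def)
    show "w k = \<omega> k (trajectory \<theta> \<pi> w s1 k)" if "k \<in> {1..N}" for k
      using that by (simp add: traj) (simp add: w_def)
  qed
qed

theorem proposition1: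
  fixes N :: nat
    and S :: "nat \<Rightarrow> (real ^ 'n) set"
    and D :: "nat \<Rightarrow> real ^ 'n \<Rightarrow> (real ^ 'n) set"
    and W :: "nat \<Rightarrow> real ^ 'n \<Rightarrow> real ^ 'n \<Rightarrow> 'w set"
    and g :: "nat \<Rightarrow> real ^ 'n \<Rightarrow> real ^ 'n \<Rightarrow> real"
    and \<epsilon> :: "nat \<Rightarrow> 'w \<Rightarrow> real"
    and \<theta> :: "nat \<Rightarrow> 'w \<Rightarrow> real ^ 'n"
    and s1 :: "real ^ 'n"
  assumes D_nonempty: "\<And>k s. k \<in> {1..N} \<Longrightarrow> s \<in> S k \<Longrightarrow> D k s \<noteq> {}"
    and W_nonempty: "\<And>k s d. k \<in> {1..N} \<Longrightarrow> s \<in> S k \<Longrightarrow> d \<in> D k s \<Longrightarrow> W k s d \<noteq> {}"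
    and next_state: "\<And>k s d w. k \<in> {1..N} \<Longrightarrow> s \<in> S k \<Longrightarrow> d \<in> D k s \<Longrightarrow> w \<in> W k s d \<Longrightarrow>
          d + \<theta> k w \<in> S (k + 1)"
    and bounded: "\<And>k. k \<in> {1..N + 1} \<Longrightarrow> \<exists>B::real. \<forall>s\<in>S k. \<bar>J_DP N D W g \<epsilon> \<theta> k s\<bar> \<le> ereal B"
    and s1: "s1 \<in> S 1"
    and optimal: "optimal_solution_exists N S D W g \<epsilon> \<theta> s1"
  shows "J_opt N S D W g \<epsilon> \<theta> s1 = J_DP N D W g \<epsilon> \<theta> 1 s1"
proof -
  \<comment> \<open>Real arithmetic suffices from here on; \<open>v\<close> is known to represent
    the DP value only at states in \<open>S k\<close>, which is why membership in \<open>S k\<close>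
    is tracked throughout.\<close>
  define v where "v k s = real_of_ereal (J_DP N D W g \<epsilon> \<theta> k s)" for k s
  have J_real: "J_DP N D W g \<epsilon> \<theta> k s = ereal (v k s)" if "k \<in> {1..N + 1}" "s \<in> S k" for k s
  proof -
    from bounded[OF that(1)] that(2) obtain B where "\<bar>J_DP N D W g \<epsilon> \<theta> k s\<bar> \<le> ereal B"
      by blast
    then have "\<bar>J_DP N D W g \<epsilon> \<theta> k s\<bar> \<noteq> \<infinity>"
      by auto
    then show ?thesis
      by (simp add: v_def ereal_real')
  qed
  have v_end: "v (Suc N) s = 0" for s
    by (simp add: v_def J_DP.simps)
  \<comment> \<open>The bracket of the recursion as a real number; it is meaningful because
    \<open>next_state\<close> keeps the successor in \<open>S (Suc k)\<close>.\<close>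
  define q where "q k s d w = stage_cost g \<epsilon> k s d w + v (Suc k) (d + \<theta> k w)" for k s d w
  have Bellman: "ereal (v k s) = (INF d\<in>D k s. SUP w\<in>W k s d. ereal (q k s d w))"
    if "k \<in> {1..N}" "s \<in> S k" for k s
  proof -
    have "ereal (v k s) = J_DP N D W g \<epsilon> \<theta> k s"
      using that by (simp add: J_real)
    also have "\<dots> = (INF d\<in>D k s. SUP w\<in>W k s d.
        ereal (stage_cost g \<epsilon> k s d w) + J_DP N D W g \<epsilon> \<theta> (k + 1) (d + \<theta> k w))"
      using that by (subst J_DP.simps) simp
    also have "\<dots> = (INF d\<in>D k s. SUP w\<in>W k s d. ereal (q k s d w))"
      using that next_state[OF that] by (intro INF_cong SUP_cong refl) (simp add: J_real q_def)
    finally show ?thesis .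
  qed
  have good_decision: "\<exists>d\<in>D k s. \<forall>w\<in>W k s d. q k s d w \<le> v k s + \<eta>"
    if "k \<in> {1..N}" "s \<in> S k" "\<eta> > 0" for k s \<eta>
  proof -
    \<comment> \<open>Finiteness of \<open>v k s\<close> makes this strict, so a single decision
      already has its supremum below the bound, even if the infimum is not attained.\<close>
    have "(INF d\<in>D k s. SUP w\<in>W k s d. ereal (q k s d w)) < ereal (v k s + \<eta>)"
      using that by (simp flip: Bellman)
    then obtain d where "d \<in> D k s" and d: "(SUP w\<in>W k s d. ereal (q k s d w)) < ereal (v k s + \<eta>)"
      by (auto simp: INF_less_iff)
    have "ereal (q k s d w) \<le> ereal (v k s + \<eta>)" if "w \<in> W k s d" for w
      using SUP_upper[OF that, of "\<lambda>w. ereal (q k s d w)"] d by (meson le_less_trans less_imp_le)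
    with \<open>d \<in> D k s\<close> show ?thesis
      by auto
  qed
  have bad_disturbance: "\<exists>w\<in>W k s d. v k s - \<eta> \<le> q k s d w"
    if "k \<in> {1..N}" "s \<in> S k" "d \<in> D k s" "\<eta> > 0" for k s d \<eta>
  proof -
    \<comment> \<open>The supremum for any admissible \<open>d\<close> is at least the infimum over
      decisions, hence strictly above \<open>v k s - \<eta>\<close>, so an actual disturbance
      exceeds this level.\<close>
    have "ereal (v k s - \<eta>) < ereal (v k s)"
      using that by simp
    also have "\<dots> \<le> (SUP w\<in>W k s d. ereal (q k s d w))"
      unfolding Bellman[OF that(1,2)] by (rule INF_lower[OF that(3)])
    finally show ?thesis
      by (force simp: less_SUP_iff)
  qed
  have "J_opt N S D W g \<epsilon> \<theta> s1 = ereal (v 1 s1)"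
  proof (rule antisym)
    show "J_opt N S D W g \<epsilon> \<theta> s1 \<le> ereal (v 1 s1)"
    proof (rule ereal_le_epsilon2)
      fix e :: real
      assume "e > 0"
      \<comment> \<open>Splits \<open>e\<close> over the stages; dividing by \<open>Suc N\<close>
        keeps \<eta> well defined and positive for \<open>N = 0\<close>.\<close>
      define \<eta> where "\<eta> = e / real (Suc N)"
      have \<eta>: "\<eta> > 0" "real N * \<eta> \<le> e"
        using \<open>e > 0\<close> by (auto simp: \<eta>_def field_simps)
      from good_decision[OF _ _ \<eta>(1)] obtain f where
        f: "\<And>k s. k \<in> {1..N} \<Longrightarrow> s \<in> S k \<Longrightarrow> f k s \<in> D k s \<and>
            (\<forall>w\<in>W k s (f k s). q k s (f k s) w \<le> v k s + \<eta>)"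
        by metis
      \<comment> \<open>Restricted in both arguments, since \<open>policies\<close> is a nested
        extensional product.\<close>
      define \<pi> where "\<pi> = restrict (\<lambda>k. restrict (f k) (S k)) {1..N}"
      have \<pi>: "\<pi> \<in> policies N S D"
        unfolding policies_def \<pi>_def using f by (intro restrict_PiE_iff[THEN iffD2] ballI) auto
      have "total_cost N g \<epsilon> \<theta> \<pi> w s1 \<le> v 1 s1 + e" if w: "w \<in> disturbances N W \<theta> \<pi> s1" for w
      proof -
        let ?t = "trajectory \<theta> \<pi> w s1"
        have "stage_cost g \<epsilon> k (?t k) (\<pi> k (?t k)) (w k) + v (Suc k) (?t (Suc k)) \<le> v k (?t k) + \<eta>"
          if k: "k \<in> {1..N}" for k
        proof -
          have "?t k \<in> S k"
            using trajectory_mem[OF next_state s1 \<pi> w] k by simp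
          then have "q k (?t k) (\<pi> k (?t k)) (w k) \<le> v k (?t k) + \<eta>"
            using f[OF k, of "?t k"] disturbances_apply_mem[OF w k] k by (simp add: \<pi>_def)
          \<comment> \<open>As \<open>k\<close> is at least 1, \<open>?t (Suc k)\<close> unfolds to
            exactly the successor state inside \<open>q\<close>.\<close>
          then show ?thesis
            using k by (simp add: q_def)
        qed
        \<comment> \<open>The ends of the telescope are \<open>?t 1 = s1\<close> and the terminal
          value 0 from \<open>v_end\<close>.\<close>
        from telescoping_upper[where N = N and c = "\<lambda>k. stage_cost g \<epsilon> k (?t k) (\<pi> k (?t k)) (w k)"
          and x = "\<lambda>k. v k (?t k)", OF this]
      show ?thesis
          using \<eta>(2) by (simp add: total_cost_def v_end)
      qed
      then have "worst_case_cost N W g \<epsilon> \<theta> \<pi> s1 \<le> ereal (v 1 s1) + ereal e"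
        unfolding worst_case_cost_def by (auto intro!: SUP_least)
      then show "J_opt N S D W g \<epsilon> \<theta> s1 \<le> ereal (v 1 s1) + ereal e"
        unfolding J_opt_def using \<pi> by (rule INF_lower2[rotated])
    qed
    show "ereal (v 1 s1) \<le> J_opt N S D W g \<epsilon> \<theta> s1"
      unfolding J_opt_def
    proof (rule INF_greatest, rule ereal_le_epsilon2)
      fix \<pi> and e :: real
      assume \<pi>: "\<pi> \<in> policies N S D" and "e > 0"
      define \<eta> where "\<eta> = e / real (Suc N)"
      have \<eta>: "\<eta> > 0" "real N * \<eta> \<le> e"
        using \<open>e > 0\<close> by (auto simp: \<eta>_def field_simps)
      \<comment> \<open>The policy is fixed before \<omega> is chosen, so the disturbance may react
        to the decision \<open>\<pi> k s\<close>.\<close>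
      from bad_disturbance[OF _ _ policies_apply_mem[OF \<pi>] \<eta>(1)] obtain \<omega> where
        \<omega>: "\<And>k s. k \<in> {1..N} \<Longrightarrow> s \<in> S k \<Longrightarrow> \<omega> k s \<in> W k s (\<pi> k s)"
          "\<And>k s. k \<in> {1..N} \<Longrightarrow> s \<in> S k \<Longrightarrow> v k s - \<eta> \<le> q k s (\<pi> k s) (\<omega> k s)"
        by metis
      obtain w where w: "w \<in> disturbances N W \<theta> \<pi> s1"
        and w_eq: "\<And>k. k \<in> {1..N} \<Longrightarrow> w k = \<omega> k (trajectory \<theta> \<pi> w s1 k)"
        by (rule feedback_disturbance_exists[where N = N and S = S and D = D and W = W and \<theta> = \<theta>
              and \<pi> = \<pi> and \<omega> = \<omega> and ?s1.0 = s1])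
          (use next_state s1 \<pi> \<omega>(1) in blast)+
      let ?t = "trajectory \<theta> \<pi> w s1"
      have "v k (?t k) - \<eta> \<le> stage_cost g \<epsilon> k (?t k) (\<pi> k (?t k)) (w k) + v (Suc k) (?t (Suc k))"
        if k: "k \<in> {1..N}" for k
      proof -
        have "?t k \<in> S k"
          using trajectory_mem[OF next_state s1 \<pi> w] k by simp
        then show ?thesis
          using \<omega>(2)[OF k, of "?t k"] w_eq[OF k] k by (simp add: q_def)
      qed
      from telescoping_lower[where N = N and c = "\<lambda>k. stage_cost g \<epsilon> k (?t k) (\<pi> k (?t k)) (w k)"
          and x = "\<lambda>k. v k (?t k)", OF this]
      have "v 1 s1 \<le> total_cost N g \<epsilon> \<theta> \<pi> w s1 + e"
        using \<eta>(2) by (simp add: total_cost_def v_end)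
      then have "ereal (v 1 s1) \<le> ereal (total_cost N g \<epsilon> \<theta> \<pi> w s1) + ereal e"
        by simp
      also have "\<dots> \<le> worst_case_cost N W g \<epsilon> \<theta> \<pi> s1 + ereal e"
        unfolding worst_case_cost_def using w by (intro add_right_mono SUP_upper)
      finally show "ereal (v 1 s1) \<le> worst_case_cost N W g \<epsilon> \<theta> \<pi> s1 + ereal e" .
    qed
  qed
  also have "\<dots> = J_DP N D W g \<epsilon> \<theta> 1 s1"
    using s1 by (simp add: J_real)
  finally show ?thesis .
qed

end
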